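(* For any two positive integers $l$ and $n$, $a(l n) \geq a(l)\, a(n)$, where $a$ is the number of recursive divisors.
   Context: For positive integers, write $m \lfloor n$ to mean that $m$ is a proper divisor of $n$ (i.e. $m \mid n$ and $m < n$). The number of recursive divisors $a:\mathbb{Z}_{>0}\to\mathbb{Z}_{>0}$ is defined recursively by $a(1)=1$ and $a(n) = 1 + \sum_{m \lfloor n} a(m)$ for $n>1$. *)

theory Defs
  imports Main
begin

definition proper_dvd :: "nat \<Rightarrow> nat \<Rightarrow> bool" where
  "proper_dvd m n \<longleftrightarrow> m dvd n \<and> m < n"

text \<open>Only positive arguments are meaningful: for \<open>n > 0\<close> every \<open>m\<close> with \<open>proper_dvd m n\<close>
  is positive, so the recursion never reaches the junk value at \<open>0\<close> (which is \<open>1\<close>).\<close>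

function recursive_divisors :: "nat \<Rightarrow> nat" where
  "recursive_divisors n =
     (if n = 1 then 1 else 1 + (\<Sum>m | proper_dvd m n. recursive_divisors m))"
  by auto
termination
  by (relation "measure id") (auto simp: proper_dvd_def)

declare recursive_divisors.simps [simp del]

end

theory Submission imports Defs begin

text \<open>The proper divisors of \<open>l\<close> (all \<open>< l\<close>) and the numbers \<open>l * m\<close> with \<open>m\<close> a proper
  divisor of \<open>n\<close> (all \<open>\<ge> l\<close>) are pairwise distinct proper divisors of \<open>l * n\<close>. By induction
  on \<open>n\<close>, the former contribute at least \<open>a(l) - 1\<close> to \<open>a(l n)\<close> and the latter at least
  \<open>a(l) (a(n) - 1)\<close>.\<close>

lemma finite_proper_dvd: "finite {m. proper_dvd m n}"
  by (rule finite_subset[of _ "{..<n}"]) (auto simp: proper_dvd_def)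

text \<open>As 1 has no proper divisors, the sum is empty at \<open>n = 1\<close>, so one equation
  covers every case.\<close>

lemma recursive_divisors_eq:
  "recursive_divisors n = 1 + (\<Sum>m | proper_dvd m n. recursive_divisors m)"
proof (cases "n = 1")
  case True
  then have "{m. proper_dvd m n} = {}"
    by (auto simp: proper_dvd_def)
  with True show ?thesis
    by (subst recursive_divisors.simps) simp
next
  case False
  then show ?thesis
    by (subst recursive_divisors.simps) simp
qed

theorem theorem1:
  fixes l n :: nat
  assumes "l > 0" and "n > 0"
  shows "recursive_divisors (l * n) \<ge> recursive_divisors l * recursive_divisors n"
  using \<open>n > 0\<close>
proof (induction n rule: less_induct)
  case (less n)
  let ?a = recursive_divisors
  let ?L = "{m. proper_dvd m l}" and ?N = "{m. proper_dvd m n}"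
  \<comment> \<open>Used twice: to apply the induction hypothesis to \<open>m\<close>, and to get
    \<open>l * m \<ge> l\<close>, which keeps the two families apart.\<close>
  have pos: "m > 0" if "m \<in> ?N" for m
    using that \<open>n > 0\<close> by (auto simp: proper_dvd_def intro: Nat.gr0I)
  have disj: "?L \<inter> (*) l ` ?N = {}"
    using pos by (auto simp: proper_dvd_def)
  have "m < l * n" if "m < l" for m
    using that \<open>n > 0\<close> by (metis less_le_trans mult.right_neutral mult_le_mono2 Suc_leI One_nat_def)
  then have sub: "?L \<union> (*) l ` ?N \<subseteq> {m. proper_dvd m (l * n)}"
    using \<open>l > 0\<close> by (auto simp: proper_dvd_def)
  have "?a l * ?a n = ?a l + (\<Sum>m\<in>?N. ?a l * ?a m)"
    by (subst recursive_divisors_eq[of n]) (simp add: sum_distrib_left)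
  also have "\<dots> \<le> ?a l + (\<Sum>m\<in>?N. ?a (l * m))"
    using less.IH pos by (intro add_left_mono sum_mono) (auto simp: proper_dvd_def)
  also have "(\<Sum>m\<in>?N. ?a (l * m)) = sum ?a ((*) l ` ?N)"
    using \<open>l > 0\<close> by (subst sum.reindex) (auto simp: inj_on_def)
  \<comment> \<open>The summand \<open>?a l\<close>, left whole so far, is unfolded here: it
    supplies both the leading 1 and the sum over \<open>?L\<close>.\<close>
  also have "?a l + sum ?a ((*) l ` ?N) = 1 + sum ?a (?L \<union> (*) l ` ?N)"
    using disj by (subst recursive_divisors_eq[of l])
      (simp add: sum.union_disjoint finite_proper_dvd)
  also have "\<dots> \<le> 1 + (\<Sum>m | proper_dvd m (l * n). ?a m)"
    using sub by (intro add_left_mono sum_mono2 finite_proper_dvd) auto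
  also have "\<dots> = ?a (l * n)"
    by (rule recursive_divisors_eq[symmetric])
  finally show ?case .
qed

end
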